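(* Let $c>0$ be a real constant, let $(X,d)$ be a complete $c$-relaxed metric space or a complete $c$-inframetric space, and let $\varphi\colon\mathbb{R}_+\to\mathbb{R}_+$ be a comparison function. Then every $\varphi$-contraction $T\colon X\to X$ has a unique fixed point.
   Context: $\mathbb{R}_+=[0,\infty)$. A semimetric space is a pair $(X,d)$ where $X$ is a nonempty set and $d\colon X\times X\to\mathbb{R}_+$ is symmetric and satisfies $d(x,y)=0$ if and only if $x=y$ (no triangle inequality is assumed). A semimetric space $(X,d)$ is a $c$-relaxed metric space if $d(x,y)\le c\,(d(x,z)+d(y,z))$ for all $x,y,z\in X$, and a $c$-inframetric space if $d(x,y)\le c\max\{d(x,z),d(y,z)\}$ for all $x,y,z\in X$. A sequence $(x_n)$ converges to $x\in X$ if $d(x_n,x)\to 0$; it is Cauchy if for every $\varepsilon>0$ there is $N$ such that $d(x_n,x_m)<\varepsilon$ for all $n,m\ge N$. The space is complete if every Cauchy sequence converges to some point of $X$. A comparison function is a monotone increasing (i.e. nondecreasing) function $\varphi\colon\mathbb{R}_+\to\mathbb{R}_+$ such that $\lim_{n\to\infty}\varphi^n(t)=0$ for all $t\ge 0$, where $\varphi^n$ is the $n$-th iterate. Given a comparison function $\varphi$, a mapping $T\colon X\to X$ is a $\varphi$-contraction if $d(Tx,Ty)\le\varphi(d(x,y))$ for all $x,y\in X$. *)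

theory Defs
  imports "HOL-Analysis.Analysis"
begin

(* Spaces are carrier sets X in a type 'a with a function d; only the values of d
   (and of self-maps) on X matter.  The half-line [0,\<infinity>) is the set {0..} :: real set. *)

definition semimetric_space :: "'a set \<Rightarrow> ('a \<Rightarrow> 'a \<Rightarrow> real) \<Rightarrow> bool" where
  "semimetric_space X d \<longleftrightarrow>
     X \<noteq> {} \<and>
     (\<forall>x\<in>X. \<forall>y\<in>X. 0 \<le> d x y) \<and>
     (\<forall>x\<in>X. \<forall>y\<in>X. d x y = d y x) \<and>
     (\<forall>x\<in>X. \<forall>y\<in>X. d x y = 0 \<longleftrightarrow> x = y)"

definition relaxed_metric_space :: "real \<Rightarrow> 'a set \<Rightarrow> ('a \<Rightarrow> 'a \<Rightarrow> real) \<Rightarrow> bool" where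
  "relaxed_metric_space c X d \<longleftrightarrow>
     semimetric_space X d \<and>
     (\<forall>x\<in>X. \<forall>y\<in>X. \<forall>z\<in>X. d x y \<le> c * (d x z + d y z))"

definition inframetric_space :: "real \<Rightarrow> 'a set \<Rightarrow> ('a \<Rightarrow> 'a \<Rightarrow> real) \<Rightarrow> bool" where
  "inframetric_space c X d \<longleftrightarrow>
     semimetric_space X d \<and>
     (\<forall>x\<in>X. \<forall>y\<in>X. \<forall>z\<in>X. d x y \<le> c * max (d x z) (d y z))"

definition semimetric_converges :: "('a \<Rightarrow> 'a \<Rightarrow> real) \<Rightarrow> (nat \<Rightarrow> 'a) \<Rightarrow> 'a \<Rightarrow> bool" where
  "semimetric_converges d s x \<longleftrightarrow> (\<lambda>n. d (s n) x) \<longlonglongrightarrow> 0"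

definition semimetric_Cauchy :: "('a \<Rightarrow> 'a \<Rightarrow> real) \<Rightarrow> (nat \<Rightarrow> 'a) \<Rightarrow> bool" where
  "semimetric_Cauchy d s \<longleftrightarrow> (\<forall>\<epsilon>>0. \<exists>N. \<forall>n\<ge>N. \<forall>m\<ge>N. d (s n) (s m) < \<epsilon>)"

definition semimetric_complete :: "'a set \<Rightarrow> ('a \<Rightarrow> 'a \<Rightarrow> real) \<Rightarrow> bool" where
  "semimetric_complete X d \<longleftrightarrow>
     (\<forall>s. range s \<subseteq> X \<and> semimetric_Cauchy d s \<longrightarrow> (\<exists>x\<in>X. semimetric_converges d s x))"

definition comparison_function :: "(real \<Rightarrow> real) \<Rightarrow> bool" where
  "comparison_function \<phi> \<longleftrightarrow>
     \<phi> \<in> {0..} \<rightarrow> {0..} \<and>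
     mono_on {0..} \<phi> \<and>
     (\<forall>t\<ge>0. (\<lambda>n. (\<phi> ^^ n) t) \<longlonglongrightarrow> 0)"

definition phi_contraction ::
    "(real \<Rightarrow> real) \<Rightarrow> 'a set \<Rightarrow> ('a \<Rightarrow> 'a \<Rightarrow> real) \<Rightarrow> ('a \<Rightarrow> 'a) \<Rightarrow> bool" where
  "phi_contraction \<phi> X d T \<longleftrightarrow>
     T \<in> X \<rightarrow> X \<and> (\<forall>x\<in>X. \<forall>y\<in>X. d (T x) (T y) \<le> \<phi> (d x y))"

end

theory Submission
  imports Defs
begin

text \<open>
  Both kinds of spaces are \<open>K\<close>-inframetric for \<open>K = max 1 (2 * c)\<close>, so only inframetric spaces
  with \<open>K \<ge> 1\<close> have to be treated.

  The difficulty is that chaining the inframetric inequality along an orbit \<open>x\<^sub>n = T\<^sup>n x\<^sub>0\<close> step by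
  step multiplies a factor \<open>K\<close> at each step. The remedy is to advance in blocks of \<open>k\<close> steps: given
  \<open>\<epsilon> > 0\<close>, the iterate \<open>\<phi>\<^sup>k\<close> maps \<open>\<epsilon>\<close> below \<open>\<epsilon> / K\<close> once \<open>k\<close> is large, and this gain
  cancels one factor \<open>K\<close>. Hence, if the first \<open>k\<close> points after \<open>x\<^sub>n\<close> lie within \<open>\<epsilon> / K\<close> of \<open>x\<^sub>n\<close>
  (true for large \<open>n\<close>, as only finitely many sequences tending to \<open>0\<close> are involved), the ball of
  radius \<open>\<epsilon>\<close> about \<open>x\<^sub>n\<close> is never left again, and the orbit is Cauchy (lemmas
  \<open>orbit_stays_in_ball\<close> and \<open>orbit_Cauchy\<close>). Since \<open>\<phi> t \<le> t\<close>, the map \<open>T\<close> is nonexpansive, so the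
  limit of the orbit is a fixed point (\<open>orbit_limit_fixed\<close>). It is unique because the distance
  between two fixed points is at most \<open>\<phi>\<^sup>n\<close> of itself for every \<open>n\<close>.
\<close>

lemma inframetric_space_mono:
  assumes "inframetric_space c X d" "c \<le> c'"
  shows "inframetric_space c' X d"
  unfolding inframetric_space_def
proof (intro conjI ballI)
  show "semimetric_space X d"
    using assms(1) by (simp add: inframetric_space_def)
  fix x y z assume "x \<in> X" "y \<in> X" "z \<in> X"
  moreover from this have "0 \<le> max (d x z) (d y z)"
    using assms(1) by (auto simp: inframetric_space_def semimetric_space_def le_max_iff_disj)
  ultimately show "d x y \<le> c' * max (d x z) (d y z)"
    using assms mult_right_mono[OF assms(2)] unfolding inframetric_space_def
    by (meson order_trans)
qed

lemma relaxed_metric_imp_inframetric: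
  assumes "relaxed_metric_space c X d" "0 \<le> c"
  shows "inframetric_space (2 * c) X d"
  unfolding inframetric_space_def
proof (intro conjI ballI)
  show "semimetric_space X d"
    using assms(1) by (simp add: relaxed_metric_space_def)
  fix x y z assume "x \<in> X" "y \<in> X" "z \<in> X"
  then have "d x y \<le> c * (d x z + d y z)"
    using assms(1) by (simp add: relaxed_metric_space_def)
  also have "\<dots> \<le> c * (2 * max (d x z) (d y z))"
    using assms(2) by (intro mult_left_mono) auto
  finally show "d x y \<le> 2 * c * max (d x z) (d y z)"
    by (simp add: mult_ac)
qed

lemma inframetric_le:
  assumes "inframetric_space K X d" "0 \<le> K" "x \<in> X" "y \<in> X" "z \<in> X"
    and "d x z \<le> r" "d y z \<le> r"
  shows "d x y \<le> K * r"
proof -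
  have "d x y \<le> K * max (d x z) (d y z)"
    using assms by (simp add: inframetric_space_def)
  also have "\<dots> \<le> K * r"
    using assms by (intro mult_left_mono) auto
  finally show ?thesis .
qed

lemma comparison_function_funpow:
  assumes "comparison_function \<phi>"
  shows "\<phi> ^^ n \<in> {0..} \<rightarrow> {0..}" "mono_on {0..} (\<phi> ^^ n)"
proof -
  show nonneg: "\<phi> ^^ n \<in> {0..} \<rightarrow> {0..}" for n
    using assms by (induction n) (auto simp: comparison_function_def Pi_iff)
  show "mono_on {0..} (\<phi> ^^ n)"
  proof (induction n)
    case (Suc n)
    then show ?case
      using assms nonneg[of n]
      by (auto simp: comparison_function_def mono_on_def Pi_iff)
  qed (auto simp: mono_on_def)
qed

text \<open>If \<open>\<phi> t > t\<close>, monotonicity would keep all later iterates of \<open>t\<close> at least \<open>\<phi> t > 0\<close>, so that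
  they could not tend to \<open>0\<close>.\<close>

lemma comparison_function_le:
  assumes "comparison_function \<phi>" "0 \<le> t"
  shows "\<phi> t \<le> t"
proof (rule ccontr)
  assume "\<not> \<phi> t \<le> t"
  then have less: "t < \<phi> t" by simp
  have ge: "\<phi> t \<le> (\<phi> ^^ Suc n) t" for n
  proof (induction n)
    case (Suc n)
    then have "\<phi> t \<le> \<phi> ((\<phi> ^^ Suc n) t)"
      using assms less by (intro mono_onD[of "{0..}" \<phi>]) (auto simp: comparison_function_def)
    then show ?case by simp
  qed simp
  have "(\<lambda>n. (\<phi> ^^ Suc n) t) \<longlonglongrightarrow> 0"
    using assms by (intro LIMSEQ_Suc) (simp add: comparison_function_def)
  then have "\<phi> t \<le> 0"
    using ge by (intro LIMSEQ_le_const) auto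
  then show False
    using less assms(2) by simp
qed

lemma phi_contraction_funpow:
  assumes "semimetric_space X d" "comparison_function \<phi>" "phi_contraction \<phi> X d T"
  shows "phi_contraction (\<phi> ^^ n) X d (T ^^ n)"
proof (induction n)
  case 0
  then show ?case by (simp add: phi_contraction_def)
next
  case (Suc n)
  have mem: "(T ^^ n) x \<in> X" if "x \<in> X" for x
    using Suc that by (auto simp: phi_contraction_def)
  show ?case
    unfolding phi_contraction_def
  proof (intro conjI ballI)
    show "T ^^ Suc n \<in> X \<rightarrow> X"
      using assms(3) mem by (auto simp: phi_contraction_def)
    fix x y assume xy: "x \<in> X" "y \<in> X"
    have "d (T ((T ^^ n) x)) (T ((T ^^ n) y)) \<le> \<phi> (d ((T ^^ n) x) ((T ^^ n) y))"
      using assms(3) mem xy by (simp add: phi_contraction_def)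
    also have "\<dots> \<le> \<phi> ((\<phi> ^^ n) (d x y))"
    proof (rule mono_onD[of "{0..}" \<phi>])
      show "d ((T ^^ n) x) ((T ^^ n) y) \<le> (\<phi> ^^ n) (d x y)"
        using Suc xy by (simp add: phi_contraction_def)
      moreover show "d ((T ^^ n) x) ((T ^^ n) y) \<in> {0..}"
        using assms(1) mem xy by (simp add: semimetric_space_def)
      ultimately show "(\<phi> ^^ n) (d x y) \<in> {0..}" by auto
    qed (use assms(2) in \<open>simp add: comparison_function_def\<close>)
    finally show "d ((T ^^ Suc n) x) ((T ^^ Suc n) y) \<le> (\<phi> ^^ Suc n) (d x y)" by simp
  qed
qed

text \<open>The block argument: to bound the distance from \<open>x\<close> to \<open>T\<^sup>m x\<close> with \<open>m > k\<close>, pass through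
  \<open>T\<^sup>k x\<close>. The second leg is the \<open>T\<^sup>k\<close>-image of the pair \<open>x\<close>, \<open>T\<^bsup>m-k\<^esup> x\<close>, at distance at most \<open>\<epsilon>\<close> by
  induction, so its length is at most \<open>\<epsilon> / K\<close>; the first leg is short by hypothesis.\<close>

lemma orbit_stays_in_ball:
  assumes space: "inframetric_space K X d" and K: "1 \<le> K"
    and comp: "comparison_function \<phi>" and contr: "phi_contraction \<phi> X d T"
    and x: "x \<in> X" and \<epsilon>: "0 \<le> \<epsilon>"
    and k: "0 < k" "(\<phi> ^^ k) \<epsilon> \<le> \<epsilon> / K"
    and start: "\<And>j. j \<le> k \<Longrightarrow> d x ((T ^^ j) x) \<le> \<epsilon> / K"
  shows "d x ((T ^^ m) x) \<le> \<epsilon>"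
proof (induction m rule: less_induct)
  case (less m)
  have semi: "semimetric_space X d"
    using space by (simp add: inframetric_space_def)
  have mem: "(T ^^ n) x \<in> X" for n
    using phi_contraction_funpow[OF semi comp contr, of n] x by (auto simp: phi_contraction_def)
  show ?case
  proof (cases "m \<le> k")
    case True
    have "\<epsilon> / K \<le> \<epsilon>"
      using K \<epsilon> by (simp add: divide_le_eq mult_le_cancel_left1)
    with start[OF True] show ?thesis by simp
  next
    case False
    define y where "y = (T ^^ (m - k)) x"
    have y: "y \<in> X" "d x y \<le> \<epsilon>"
      using mem less[of "m - k"] k False by (auto simp: y_def)
    have Tky: "(T ^^ k) y = (T ^^ m) x"
      using False by (simp add: y_def flip: funpow_add comp_apply[of "T ^^ k" "T ^^ (m - k)"])
    have nonneg: "0 \<le> d x y" and sym: "d ((T ^^ m) x) ((T ^^ k) x) = d ((T ^^ k) x) ((T ^^ m) x)"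
      using semi x y mem by (auto simp: semimetric_space_def)
    have "d ((T ^^ k) x) ((T ^^ k) y) \<le> (\<phi> ^^ k) (d x y)"
      using phi_contraction_funpow[OF semi comp contr, of k] x y by (simp add: phi_contraction_def)
    also have "\<dots> \<le> (\<phi> ^^ k) \<epsilon>"
      using comparison_function_funpow(2)[OF comp] y \<epsilon> nonneg
      by (intro mono_onD[of "{0..}" "\<phi> ^^ k"]) auto
    also have "\<dots> \<le> \<epsilon> / K" by (rule k)
    finally have "d ((T ^^ m) x) ((T ^^ k) x) \<le> \<epsilon> / K"
      using sym Tky by simp
    then have "d x ((T ^^ m) x) \<le> K * (\<epsilon> / K)"
      using K x mem start[of k] by (intro inframetric_le[OF space, where z = "(T ^^ k) x"]) auto
    then show ?thesis using K by simp
  qed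
qed

lemma orbit_Cauchy:
  assumes space: "inframetric_space K X d" and K: "1 \<le> K"
    and comp: "comparison_function \<phi>" and contr: "phi_contraction \<phi> X d T"
    and x: "x \<in> X"
  shows "semimetric_Cauchy d (\<lambda>n. (T ^^ n) x)"
  unfolding semimetric_Cauchy_def
proof (intro allI impI)
  fix \<delta> :: real assume \<delta>: "0 < \<delta>"
  have semi: "semimetric_space X d"
    using space by (simp add: inframetric_space_def)
  have mem: "(T ^^ n) x \<in> X" for n
    using phi_contraction_funpow[OF semi comp contr, of n] x by (auto simp: phi_contraction_def)
  \<comment> \<open>Two points of the ball of radius \<open>\<epsilon>\<close> are at distance at most \<open>K * \<epsilon> = \<delta> / 2\<close>.\<close>
  define \<epsilon> where "\<epsilon> = \<delta> / (2 * K)"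
  have \<epsilon>: "0 < \<epsilon>" "0 < \<epsilon> / K" "K * \<epsilon> < \<delta>"
    using \<delta> K by (auto simp: \<epsilon>_def)
  have iter: "(\<lambda>n. (\<phi> ^^ n) t) \<longlonglongrightarrow> 0" if "0 \<le> t" for t
    using comp that by (simp add: comparison_function_def)
  have "eventually (\<lambda>k. (\<phi> ^^ k) \<epsilon> < \<epsilon> / K \<and> 0 < k) sequentially"
    using order_tendstoD(2)[OF iter \<epsilon>(2)] \<epsilon>(1) eventually_gt_at_top[of 0]
    by (auto intro: eventually_conj)
  then obtain k where k: "(\<phi> ^^ k) \<epsilon> < \<epsilon> / K" "0 < k"
    using eventually_happens'[OF sequentially_bot] by blast
  have "eventually (\<lambda>n. (\<phi> ^^ n) (d x ((T ^^ j) x)) < \<epsilon> / K) sequentially" for j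
    using order_tendstoD(2)[OF iter \<epsilon>(2)] semi x mem by (simp add: semimetric_space_def)
  then have "eventually (\<lambda>n. \<forall>j\<in>{..k}. (\<phi> ^^ n) (d x ((T ^^ j) x)) < \<epsilon> / K) sequentially"
    by (intro eventually_ball_finite) auto
  then obtain N where N: "(\<phi> ^^ N) (d x ((T ^^ j) x)) < \<epsilon> / K" if "j \<le> k" for j
    using eventually_happens'[OF sequentially_bot] by (metis (no_types, lifting) atMost_iff)
  have start: "d ((T ^^ N) x) ((T ^^ j) ((T ^^ N) x)) \<le> \<epsilon> / K" if "j \<le> k" for j
  proof -
    have "(T ^^ j) ((T ^^ N) x) = (T ^^ N) ((T ^^ j) x)"
      by (metis add.commute comp_apply funpow_add)
    then have "d ((T ^^ N) x) ((T ^^ j) ((T ^^ N) x)) \<le> (\<phi> ^^ N) (d x ((T ^^ j) x))"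
      using phi_contraction_funpow[OF semi comp contr, of N] x mem
      by (simp add: phi_contraction_def)
    with N[OF that] show ?thesis by simp
  qed
  have ball: "d ((T ^^ N) x) ((T ^^ n) x) \<le> \<epsilon>" if "N \<le> n" for n
  proof -
    have "(T ^^ n) x = (T ^^ (n - N)) ((T ^^ N) x)"
      using that by (metis comp_apply funpow_add le_add_diff_inverse2)
    then show ?thesis
      using orbit_stays_in_ball[OF space K comp contr mem _ k(2) _ start] \<epsilon> k by simp
  qed
  have "d ((T ^^ n) x) ((T ^^ m) x) < \<delta>" if "N \<le> n" "N \<le> m" for n m
  proof -
    have "d ((T ^^ n) x) ((T ^^ N) x) \<le> \<epsilon>" "d ((T ^^ m) x) ((T ^^ N) x) \<le> \<epsilon>"
      using ball that semi mem by (metis semimetric_space_def)+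
    then have "d ((T ^^ n) x) ((T ^^ m) x) \<le> K * \<epsilon>"
      using K mem by (intro inframetric_le[OF space]) auto
    with \<epsilon>(3) show ?thesis by simp
  qed
  then show "\<exists>N. \<forall>n\<ge>N. \<forall>m\<ge>N. d ((T ^^ n) x) ((T ^^ m) x) < \<delta>" by blast
qed

text \<open>The points \<open>T\<^bsup>n+1\<^esup> x\<close> converge to \<open>z\<close> as a tail of the orbit, and to \<open>T z\<close> because \<open>T\<close> is
  nonexpansive; the inframetric inequality makes limits unique.\<close>

lemma orbit_limit_fixed:
  assumes space: "inframetric_space K X d" and K: "0 \<le> K"
    and comp: "comparison_function \<phi>" and contr: "phi_contraction \<phi> X d T"
    and x: "x \<in> X" and z: "z \<in> X"
    and lim: "semimetric_converges d (\<lambda>n. (T ^^ n) x) z"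
  shows "T z = z"
proof -
  have semi: "semimetric_space X d"
    using space by (simp add: inframetric_space_def)
  have mem: "(T ^^ n) x \<in> X" for n
    using phi_contraction_funpow[OF semi comp contr, of n] x by (auto simp: phi_contraction_def)
  have Tz: "T z \<in> X"
    using contr z by (auto simp: phi_contraction_def)
  define s where "s n = d ((T ^^ n) x) z" for n
  have s: "s \<longlonglongrightarrow> 0"
    using lim by (simp add: semimetric_converges_def s_def[abs_def])
  have le: "d (T z) z \<le> K * max (s n) (s (Suc n))" for n
  proof (rule inframetric_le[OF space K Tz z mem[of "Suc n"]])
    have "d (T z) (T ((T ^^ n) x)) \<le> \<phi> (d z ((T ^^ n) x))"
      using contr z mem by (simp add: phi_contraction_def)
    also have "\<dots> \<le> d z ((T ^^ n) x)"
      using comparison_function_le[OF comp] semi z mem by (simp add: semimetric_space_def)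
    also have "\<dots> = s n"
      using semi z mem by (simp add: semimetric_space_def s_def)
    finally show "d (T z) ((T ^^ Suc n) x) \<le> max (s n) (s (Suc n))" by simp
    have "d z ((T ^^ Suc n) x) = s (Suc n)"
      using semi z mem[of "Suc n"] unfolding semimetric_space_def s_def by blast
    then show "d z ((T ^^ Suc n) x) \<le> max (s n) (s (Suc n))" by simp
  qed
  have "(\<lambda>n. K * max (s n) (s (Suc n))) \<longlonglongrightarrow> K * max 0 0"
    by (intro tendsto_intros s LIMSEQ_Suc[OF s])
  then have "d (T z) z \<le> 0"
    using le by (intro LIMSEQ_le_const) auto
  then show ?thesis
    using semi z Tz by (metis order_antisym semimetric_space_def)
qed

lemma phi_contraction_fixed_unique:
  assumes semi: "semimetric_space X d" and comp: "comparison_function \<phi>"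
    and contr: "phi_contraction \<phi> X d T"
    and xy: "x \<in> X" "T x = x" "y \<in> X" "T y = y"
  shows "x = y"
proof -
  have nonneg: "0 \<le> d x y"
    using semi xy by (simp add: semimetric_space_def)
  have "(T ^^ n) x = x" "(T ^^ n) y = y" for n
    using xy by (induction n) auto
  then have "d x y \<le> (\<phi> ^^ n) (d x y)" for n
    using phi_contraction_funpow[OF semi comp contr, of n] xy
    by (metis phi_contraction_def)
  moreover have "(\<lambda>n. (\<phi> ^^ n) (d x y)) \<longlonglongrightarrow> 0"
    using comp nonneg by (simp add: comparison_function_def)
  ultimately have "d x y \<le> 0"
    by (intro LIMSEQ_le_const) auto
  then show ?thesis
    using semi xy nonneg by (simp add: semimetric_space_def)
qed

theorem corollary1:
  fixes c :: real and X :: "'a set" and d :: "'a \<Rightarrow> 'a \<Rightarrow> real"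
    and \<phi> :: "real \<Rightarrow> real" and T :: "'a \<Rightarrow> 'a"
  assumes "c > 0"
    and "relaxed_metric_space c X d \<or> inframetric_space c X d"
    and "semimetric_complete X d"
    and "comparison_function \<phi>"
    and "phi_contraction \<phi> X d T"
  shows "\<exists>!x. x \<in> X \<and> T x = x"
proof -
  define K where "K = max 1 (2 * c)"
  have K: "1 \<le> K" "c \<le> K" "2 * c \<le> K"
    using assms(1) by (auto simp: K_def)
  have space: "inframetric_space K X d"
    using assms(1,2) K
    by (auto intro: inframetric_space_mono dest: relaxed_metric_imp_inframetric)
  then have semi: "semimetric_space X d"
    by (simp add: inframetric_space_def)
  then obtain x where x: "x \<in> X"
    by (auto simp: semimetric_space_def)
  have "range (\<lambda>n. (T ^^ n) x) \<subseteq> X"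
    using phi_contraction_funpow[OF semi assms(4,5)] x by (auto simp: phi_contraction_def)
  moreover have "semimetric_Cauchy d (\<lambda>n. (T ^^ n) x)"
    by (rule orbit_Cauchy[OF space K(1) assms(4,5) x])
  ultimately obtain z where z: "z \<in> X" "semimetric_converges d (\<lambda>n. (T ^^ n) x) z"
    using assms(3) unfolding semimetric_complete_def by blast
  have "T z = z"
    using orbit_limit_fixed[OF space _ assms(4,5) x z] K(1) by simp
  with z(1) show ?thesis
    using phi_contraction_fixed_unique[OF semi assms(4,5)] by blast
qed

end
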